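(* The model checking problem for $\mathrm{EG}$ formulae over gap-order constraint systems is undecidable. That is, there is no algorithm which, given a GCS $\mathcal{G}=(\mathit{Var},\mathit{Const},\mathit{Act},\Delta,\lambda)$, a valuation $\nu:\mathit{Var}\to\mathbb{Z}$ and an $\mathrm{EG}$ formula $\psi$, decides whether $\nu\models\psi$ (i.e.\ whether $\nu\in[\![\psi]\!]$).
   Context: Fix finite sets $\mathit{Var}$ of variables (ranging over $\mathbb{Z}$) and $\mathit{Const}\subseteq\mathbb{Z}$ of constants. A valuation is a map $\nu:\mathit{Var}\to\mathbb{Z}$, extended by $\nu(c)=c$ for constants $c$; $\mathit{Val}$ is the set of valuations. A gap clause is an inequation $x-y\ge k$ with $x,y\in\mathit{Var}\cup\mathit{Const}$ and $k\in\mathbb{Z}$; it is positive if $k\in\mathbb{N}$. $\nu$ satisfies it iff $\nu(x)-\nu(y)\ge k$. A (positive) gap constraint is a finite conjunction of (positive) gap clauses. Let $\mathit{Var}'=\{x'\mid x\in\mathit{Var}\}$ be primed copies; a transitional gap constraint is a gap constraint over variables $\mathit{Var}\cup\mathit{Var}'$. For valuations $\nu,\nu'$, let $\nu\oplus\nu'$ map $x\mapsto\nu(x)$ and $x'\mapsto\nu'(x)$. A gap-order constraint system (GCS) is a tuple $\mathcal{G}=(\mathit{Var},\mathit{Const},\mathit{Act},\Delta,\lambda)$ where $\mathit{Act}$ is a finite set of actions, $\Delta$ a finite set of positive transitional gap constraints and $\lambda:\Delta\to\mathit{Act}$. Its semantics is the labeled transition system with states $\mathit{Val}$ and $\nu\xrightarrow{a}\nu'$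 iff $\nu\oplus\nu'$ satisfies some $C\in\Delta$ with $\lambda(C)=a$. $\mathrm{EG}$ formulae are given by $\psi::=C\mid \mathit{true}\mid\neg\psi\mid\psi\wedge\psi\mid\langle a\rangle\psi\mid \mathrm{EG}\,\psi$, where $C$ ranges over gap clauses and $a\in\mathit{Act}$. Semantics: $[\![C]\!]$ is the set of valuations satisfying $C$; $[\![\mathit{true}]\!]=\mathit{Val}$; negation and conjunction are complement and intersection; $[\![\langle a\rangle\psi]\!]=\{\nu\mid\exists\nu'\in[\![\psi]\!].\ \nu\xrightarrow{a}\nu'\}$; $[\![\mathrm{EG}\,\psi]\!]$ is the set of $\nu_0$ from which there is an infinite path $\nu_0\xrightarrow{a_0}\nu_1\xrightarrow{a_1}\cdots$ with all $\nu_i\in[\![\psi]\!]$. *)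

theory Defs
  imports Main "HOL-Library.FuncSet" "HOL-Library.Nat_Bijection"
begin

datatype 'v gap_term = Var 'v | Const int

text \<open>\<open>Gap s t k\<close> is the inequation \<open>s - t \<ge> k\<close>.\<close>

datatype 'v gap_clause = Gap "'v gap_term" "'v gap_term" int

primrec term_val :: "('v \<Rightarrow> int) \<Rightarrow> 'v gap_term \<Rightarrow> int" where
  "term_val \<nu> (Var x) = \<nu> x"
| "term_val \<nu> (Const c) = c"

primrec clause_sat :: "('v \<Rightarrow> int) \<Rightarrow> 'v gap_clause \<Rightarrow> bool" where
  "clause_sat \<nu> (Gap s t k) \<longleftrightarrow> term_val \<nu> s - term_val \<nu> t \<ge> k"

primrec positive_clause :: "'v gap_clause \<Rightarrow> bool" where
  "positive_clause (Gap s t k) \<longleftrightarrow> k \<ge> 0"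

primrec clause_over :: "'v set \<Rightarrow> int set \<Rightarrow> 'v gap_clause \<Rightarrow> bool" where
  "clause_over V K (Gap s t k) \<longleftrightarrow> {s, t} \<subseteq> Var ` V \<union> Const ` K"

text \<open>A list of clauses stands for their conjunction.\<close>

type_synonym 'v gap_constraint = "'v gap_clause list"

definition constraint_sat :: "('v \<Rightarrow> int) \<Rightarrow> 'v gap_constraint \<Rightarrow> bool" where
  "constraint_sat \<nu> C \<longleftrightarrow> (\<forall>c\<in>set C. clause_sat \<nu> c)"

definition positive_constraint :: "'v gap_constraint \<Rightarrow> bool" where
  "positive_constraint C \<longleftrightarrow> (\<forall>c\<in>set C. positive_clause c)"

definition constraint_over :: "'v set \<Rightarrow> int set \<Rightarrow> 'v gap_constraint \<Rightarrow> bool" where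
  "constraint_over V K C \<longleftrightarrow> (\<forall>c\<in>set C. clause_over V K c)"

text \<open>
  Inputs of an algorithm are finite data, so variables and actions are named by natural
  numbers. In transitional constraints \<open>Inl x\<close> is the variable \<open>x\<close> and \<open>Inr x\<close> its primed copy.
\<close>

record gcs =
  variables :: "nat set"
  constants :: "int set"
  actions :: "nat set"
  transitions :: "(nat + nat) gap_constraint set"
  label :: "(nat + nat) gap_constraint \<Rightarrow> nat"

definition gap_order_constraint_system :: "gcs \<Rightarrow> bool" where
  "gap_order_constraint_system G \<longleftrightarrow>
     finite (variables G) \<and> finite (constants G) \<and> finite (actions G) \<and>
     finite (transitions G) \<and>
     (\<forall>C\<in>transitions G. positive_constraint C \<and>
        constraint_over (variables G <+> variables G) (constants G) C) \<and>
     label G \<in> transitions G \<rightarrow> actions G"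

definition valuations :: "gcs \<Rightarrow> (nat \<Rightarrow> int) set" where
  "valuations G = variables G \<rightarrow>\<^sub>E UNIV"

text \<open>\<open>case_sum \<nu> \<nu>'\<close> is the combined valuation of unprimed and primed variables.\<close>

definition step :: "gcs \<Rightarrow> (nat \<Rightarrow> int) \<Rightarrow> nat \<Rightarrow> (nat \<Rightarrow> int) \<Rightarrow> bool" where
  "step G \<nu> a \<nu>' \<longleftrightarrow> \<nu> \<in> valuations G \<and> \<nu>' \<in> valuations G \<and>
     (\<exists>C\<in>transitions G. label G C = a \<and> constraint_sat (case_sum \<nu> \<nu>') C)"

datatype eg_formula =
    Clause "nat gap_clause"
  | TT
  | Neg eg_formula
  | Conj eg_formula eg_formula
  | Diamond nat eg_formula
  | EG eg_formula

primrec formula_over :: "gcs \<Rightarrow> eg_formula \<Rightarrow> bool" where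
  "formula_over G (Clause c) \<longleftrightarrow> clause_over (variables G) (constants G) c"
| "formula_over G TT \<longleftrightarrow> True"
| "formula_over G (Neg \<psi>) \<longleftrightarrow> formula_over G \<psi>"
| "formula_over G (Conj \<phi> \<psi>) \<longleftrightarrow> formula_over G \<phi> \<and> formula_over G \<psi>"
| "formula_over G (Diamond a \<psi>) \<longleftrightarrow> a \<in> actions G \<and> formula_over G \<psi>"
| "formula_over G (EG \<psi>) \<longleftrightarrow> formula_over G \<psi>"

primrec sem :: "gcs \<Rightarrow> eg_formula \<Rightarrow> (nat \<Rightarrow> int) set" where
  "sem G (Clause c) = {\<nu> \<in> valuations G. clause_sat \<nu> c}"
| "sem G TT = valuations G"
| "sem G (Neg \<psi>) = valuations G - sem G \<psi>"
| "sem G (Conj \<phi> \<psi>) = sem G \<phi> \<inter> sem G \<psi>"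
| "sem G (Diamond a \<psi>) = {\<nu>. \<exists>\<nu>'\<in>sem G \<psi>. step G \<nu> a \<nu>'}"
| "sem G (EG \<psi>) = {\<nu>. \<exists>(\<rho> :: nat \<Rightarrow> nat \<Rightarrow> int) (\<alpha> :: nat \<Rightarrow> nat). \<rho> 0 = \<nu> \<and>
     (\<forall>i. step G (\<rho> i) (\<alpha> i) (\<rho> (Suc i)) \<and> \<rho> i \<in> sem G \<psi>)}"

type_synonym eg_instance = "gcs \<times> (nat \<Rightarrow> int) \<times> eg_formula"

definition eg_instances :: "eg_instance set" where
  "eg_instances = {(G, \<nu>, \<psi>).
     gap_order_constraint_system G \<and> \<nu> \<in> valuations G \<and> formula_over G \<psi>}"

fun eg_models :: "eg_instance \<Rightarrow> bool" where
  "eg_models (G, \<nu>, \<psi>) \<longleftrightarrow> \<nu> \<in> sem G \<psi>"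

datatype recf = Zero | Succ | Proj nat | Comp recf "recf list" | PrimRec recf recf | Mu recf

text \<open>
  \<open>computes f xs y\<close>: the program \<open>f\<close> halts on the arguments \<open>xs\<close> with result \<open>y\<close>.
  These are Kleene's partial recursive functions, without explicit arities: \<open>Zero\<close> and
  \<open>Proj i\<close> accept argument lists of any (sufficient) length.
\<close>

inductive computes :: "recf \<Rightarrow> nat list \<Rightarrow> nat \<Rightarrow> bool" where
  Zero: "computes Zero xs 0"
| Succ: "computes Succ [x] (Suc x)"
| Proj: "i < length xs \<Longrightarrow> computes (Proj i) xs (xs ! i)"
| Comp: "list_all2 (\<lambda>g y. computes g xs y) gs ys \<Longrightarrow> computes f ys z \<Longrightarrow>
     computes (Comp f gs) xs z"
| PrimRec_0: "computes f xs y \<Longrightarrow> computes (PrimRec f g) (0 # xs) y"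
| PrimRec_Suc: "computes (PrimRec f g) (n # xs) y \<Longrightarrow> computes g (n # y # xs) z \<Longrightarrow>
     computes (PrimRec f g) (Suc n # xs) z"
| Mu: "computes f (n # xs) 0 \<Longrightarrow> (\<And>m. m < n \<Longrightarrow> \<exists>y. computes f (m # xs) (Suc y)) \<Longrightarrow>
     computes (Mu f) xs n"

lemma computes_deterministic:
  "computes f xs y \<Longrightarrow> computes f xs z \<Longrightarrow> y = z"
proof (induction arbitrary: z rule: computes.induct)
  case (Comp xs gs ys f z w)
  from Comp.prems obtain ys' where ys': "list_all2 (\<lambda>g y. computes g xs y) gs ys'"
    and w: "computes f ys' w"
    by (cases rule: computes.cases) auto
  have "ys = ys'"
    using Comp.IH(1) ys' by (auto simp: list_all2_conv_all_nth intro!: nth_equalityI)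
  with Comp.IH(2) w show ?case by blast
next
  case (PrimRec_Suc f g n xs y z w)
  from PrimRec_Suc.prems obtain y' where "computes (PrimRec f g) (n # xs) y'"
    and "computes g (n # y' # xs) w"
    by (cases rule: computes.cases) auto
  with PrimRec_Suc.IH show ?case by blast
next
  case (Mu f n xs w)
  from Mu.prems have w: "computes f (w # xs) 0"
      "\<And>m. m < w \<Longrightarrow> \<exists>y. computes f (m # xs) (Suc y)"
    by (cases rule: computes.cases; auto)+
  show ?case
  proof (rule linorder_cases[of n w])
    assume "n < w"
    with w(2) Mu.IH(1) show ?thesis by blast
  next
    assume "w < n"
    with Mu.IH(2) w(1) show ?thesis by blast
  qed
qed (erule computes.cases; auto)+

text \<open>
  Decidability of the problem \<open>P\<close> on the inputs \<open>I\<close>, presented to the program via \<open>enc\<close>.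
  The program has to halt with the correct answer on codes of inputs in \<open>I\<close>;
  nothing is required on other numbers.
\<close>

definition decidable_on :: "('i \<Rightarrow> nat) \<Rightarrow> 'i set \<Rightarrow> ('i \<Rightarrow> bool) \<Rightarrow> bool" where
  "decidable_on enc I P \<longleftrightarrow>
     (\<exists>f. \<forall>i\<in>I. computes f [enc i] (if P i then 1 else 0))"

text \<open>
  Only the effective bijections of \<open>Nat_Bijection\<close> are used; the class \<open>countable\<close>
  would merely provide some unspecified, possibly non-computable injection.
  Finite sets are coded by \<open>set_encode\<close>, i.e. as bit masks.
\<close>

primrec enc_term :: "('v \<Rightarrow> nat) \<Rightarrow> 'v gap_term \<Rightarrow> nat" where
  "enc_term e (Var x) = sum_encode (Inl (e x))"
| "enc_term e (Const c) = sum_encode (Inr (int_encode c))"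

primrec enc_clause :: "('v \<Rightarrow> nat) \<Rightarrow> 'v gap_clause \<Rightarrow> nat" where
  "enc_clause e (Gap s t k) =
     prod_encode (enc_term e s, prod_encode (enc_term e t, int_encode k))"

definition enc_constraint :: "('v \<Rightarrow> nat) \<Rightarrow> 'v gap_constraint \<Rightarrow> nat" where
  "enc_constraint e C = list_encode (map (enc_clause e) C)"

text \<open>The labelling is coded as its graph, which also determines the set of transitions.\<close>

definition enc_gcs :: "gcs \<Rightarrow> nat" where
  "enc_gcs G = list_encode
     [set_encode (variables G),
      set_encode (int_encode ` constants G),
      set_encode (actions G),
      set_encode ((\<lambda>C. prod_encode (enc_constraint sum_encode C, label G C)) ` transitions G)]"

text \<open>The values of the variables are listed in increasing order of the variable names.\<close>

definition enc_valuation :: "gcs \<Rightarrow> (nat \<Rightarrow> int) \<Rightarrow> nat" where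
  "enc_valuation G \<nu> =
     list_encode (map (\<lambda>x. int_encode (\<nu> x)) (sorted_list_of_set (variables G)))"

primrec enc_formula :: "eg_formula \<Rightarrow> nat" where
  "enc_formula (Clause c) = prod_encode (0, enc_clause id c)"
| "enc_formula TT = prod_encode (1, 0)"
| "enc_formula (Neg \<psi>) = prod_encode (2, enc_formula \<psi>)"
| "enc_formula (Conj \<phi> \<psi>) = prod_encode (3, prod_encode (enc_formula \<phi>, enc_formula \<psi>))"
| "enc_formula (Diamond a \<psi>) = prod_encode (4, prod_encode (a, enc_formula \<psi>))"
| "enc_formula (EG \<psi>) = prod_encode (5, enc_formula \<psi>)"

fun enc_instance :: "eg_instance \<Rightarrow> nat" where
  "enc_instance (G, \<nu>, \<psi>) =
     prod_encode (enc_gcs G, prod_encode (enc_valuation G \<nu>, enc_formula \<psi>))"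

text \<open>
  The encoding is faithful: a code determines the instance, except for the irrelevant
  labels of constraints that are not transitions of the system.
\<close>

lemma enc_term_inject: "inj e \<Longrightarrow> enc_term e s = enc_term e t \<longleftrightarrow> s = t"
  by (cases s; cases t) (auto simp: sum_encode_eq int_encode_eq inj_eq)

lemma enc_clause_inject: "inj e \<Longrightarrow> enc_clause e c = enc_clause e d \<longleftrightarrow> c = d"
  by (cases c; cases d) (auto simp: prod_encode_eq int_encode_eq enc_term_inject)

lemma enc_constraint_inject: "inj e \<Longrightarrow> enc_constraint e C = enc_constraint e D \<longleftrightarrow> C = D"
  by (auto simp: enc_constraint_def list_encode_eq inj_map_eq_map inj_def enc_clause_inject)

lemma enc_formula_inject: "enc_formula \<phi> = enc_formula \<psi> \<longleftrightarrow> \<phi> = \<psi>"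
proof (induction \<phi> arbitrary: \<psi>)
  case (Clause c)
  show ?case by (cases \<psi>) (auto simp: prod_encode_eq enc_clause_inject)
next
  case TT
  show ?case by (cases \<psi>) (auto simp: prod_encode_eq)
next
  case (Neg \<phi>)
  then show ?case by (cases \<psi>) (auto simp: prod_encode_eq)
next
  case (Conj \<phi>1 \<phi>2)
  then show ?case by (cases \<psi>) (auto simp: prod_encode_eq)
next
  case (Diamond a \<phi>)
  then show ?case by (cases \<psi>) (auto simp: prod_encode_eq)
next
  case (EG \<phi>)
  then show ?case by (cases \<psi>) (auto simp: prod_encode_eq)
qed

lemma enc_instance_inject:
  assumes I: "(G, \<nu>, \<phi>) \<in> eg_instances" and J: "(H, \<mu>, \<psi>) \<in> eg_instances"
    and eq: "enc_instance (G, \<nu>, \<phi>) = enc_instance (H, \<mu>, \<psi>)"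
  shows "variables G = variables H" "constants G = constants H" "actions G = actions H"
    "transitions G = transitions H" "\<And>C. C \<in> transitions G \<Longrightarrow> label G C = label H C"
    "\<nu> = \<mu>" "\<phi> = \<psi>"
proof -
  let ?graph = "\<lambda>G. (\<lambda>C. prod_encode (enc_constraint sum_encode C, label G C)) ` transitions G"
  have fin: "finite (variables G)" "finite (constants G)" "finite (actions G)"
      "finite (transitions G)" "finite (variables H)" "finite (constants H)"
      "finite (actions H)" "finite (transitions H)"
    and val: "\<nu> \<in> valuations G" "\<mu> \<in> valuations H"
    using I J by (auto simp: eg_instances_def gap_order_constraint_system_def)
  have set_eq: "A = B" if "set_encode A = set_encode B" "finite A" "finite B" for A B
    using that by (metis set_encode_inverse)
  have codes: "set_encode (variables G) = set_encode (variables H)"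
      "set_encode (int_encode ` constants G) = set_encode (int_encode ` constants H)"
      "set_encode (actions G) = set_encode (actions H)"
      "set_encode (?graph G) = set_encode (?graph H)"
      "enc_valuation G \<nu> = enc_valuation H \<mu>" "enc_formula \<phi> = enc_formula \<psi>"
    using eq by (auto simp: prod_encode_eq enc_gcs_def)
  show V: "variables G = variables H"
    by (rule set_eq[OF codes(1) fin(1,5)])
  show "actions G = actions H"
    by (rule set_eq[OF codes(3) fin(3,7)])
  have "int_encode ` constants G = int_encode ` constants H"
    by (rule set_eq[OF codes(2)]) (use fin in auto)
  then show "constants G = constants H"
    by (simp add: inj_image_eq_iff inj_int_encode)
  have graph: "?graph G = ?graph H"
    by (rule set_eq[OF codes(4)]) (use fin in auto)
  have inj: "inj (sum_encode :: nat + nat \<Rightarrow> nat)"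
    by (rule inj_sum_encode)
  have *: "C \<in> transitions H \<and> label G C = label H C"
    if "?graph G = ?graph H" "C \<in> transitions G" for C G H
  proof -
    have "prod_encode (enc_constraint sum_encode C, label G C) \<in> ?graph H"
      using that by blast
    then show ?thesis by (auto simp: prod_encode_eq enc_constraint_inject[OF inj])
  qed
  show "transitions G = transitions H"
    using *[OF graph] *[OF graph[symmetric]] by blast
  show "label G C = label H C" if "C \<in> transitions G" for C
    using *[OF graph that] by blast
  have "\<nu> x = \<mu> x" if "x \<in> variables G" for x
    using codes(5) V fin that by (auto simp: enc_valuation_def list_encode_eq int_encode_eq)
  then show "\<nu> = \<mu>"
    using val V by (auto simp: valuations_def intro: PiE_ext)
  show "\<phi> = \<psi>"
    using codes(6) by (simp add: enc_formula_inject)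
qed

end

theory Submission
  imports Defs
begin

text \<open>
  Consider the system whose single transition copies every variable \<open>j < N\<close> into a variable
  \<open>N + j\<close> and then replaces it by an arbitrary natural number. Gap clauses of a formula need not
  be positive, so a formula can compare the new values with the stored old ones and thereby impose
  exact updates on a step. Hence \<open>\<langle>a\<rangle>\<close> is a quantifier over natural numbers, and \<open>EG\<close>
  iterates an update, which is what primitive recursion needs: for every partial recursive function
  some formula holds precisely on its graph.

  If \<open>f\<close> decided the problem, some formula \<open>\<phi>\<close> would therefore express, of a valuation
  holding a code of a system, a code of a formula and a code of the remaining values of that same
  valuation, that \<open>f\<close> does not answer 1 on this instance. Storing the code of \<open>\<phi>\<close>
  itself gives a contradiction.
\<close>

section \<open>The copying system\<close>

text \<open>Transitions must be positive, and the upper bound in \<open>x' = x + 1\<close> would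
  need the number -1. Two opposite clauses with bound 0 still give an exact copy; increments are
  left to the formulas.\<close>

definition copy_constraint :: "nat \<Rightarrow> (nat + nat) gap_constraint" where
  "copy_constraint N = concat (map (\<lambda>j.
     [Gap (Var (Inr j)) (Const 0) 0,
      Gap (Var (Inr (N + j))) (Var (Inl j)) 0,
      Gap (Var (Inl j)) (Var (Inr (N + j))) 0]) [0..<N])"

definition copy_gcs :: "nat \<Rightarrow> gcs" where
  "copy_gcs N = \<lparr>variables = {..<2 * N}, constants = {0}, actions = {0},
     transitions = {copy_constraint N}, label = (\<lambda>_. 0)\<rparr>"

lemma copy_gcs_sel [simp]:
  "variables (copy_gcs N) = {..<2 * N}" "constants (copy_gcs N) = {0}"
  "actions (copy_gcs N) = {0}" "transitions (copy_gcs N) = {copy_constraint N}"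
  "label (copy_gcs N) C = 0"
  by (simp_all add: copy_gcs_def)

lemma gap_order_constraint_system_copy_gcs: "gap_order_constraint_system (copy_gcs N)"
  by (auto simp: gap_order_constraint_system_def copy_constraint_def positive_constraint_def
      constraint_over_def)

text \<open>Assignments are total functions into the naturals, so that relations on them can be
  stated before \<open>N\<close> is chosen; the restriction yields a member of
  \<open>valuations\<close>.\<close>

definition nat_valuation :: "nat \<Rightarrow> (nat \<Rightarrow> nat) \<Rightarrow> nat \<Rightarrow> int" where
  "nat_valuation N \<mu> = (\<lambda>x\<in>{..<2 * N}. int (\<mu> x))"

lemma constraint_sat_copy_constraint:
  "constraint_sat (case_sum \<nu> \<nu>') (copy_constraint N) \<longleftrightarrow> (\<forall>j<N. 0 \<le> \<nu>' j \<and> \<nu>' (N + j) = \<nu> j)"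
proof -
  have "(\<forall>j\<in>{0..<N}. 0 \<le> \<nu>' j \<and> \<nu> j \<le> \<nu>' (N + j) \<and> \<nu>' (N + j) \<le> \<nu> j) \<longleftrightarrow>
      constraint_sat (case_sum \<nu> \<nu>') (copy_constraint N)"
    by (simp add: constraint_sat_def copy_constraint_def)
  then show ?thesis by (metis antisym atLeastLessThan_iff le0 order_refl)
qed

lemma nat_valuation_in_valuations [simp]: "nat_valuation N \<mu> \<in> valuations (copy_gcs N)"
  by (simp add: nat_valuation_def valuations_def)

lemma nat_valuation_apply [simp]: "x < 2 * N \<Longrightarrow> nat_valuation N \<mu> x = int (\<mu> x)"
  by (simp add: nat_valuation_def)

text \<open>Naturalness is preserved: the constraint makes the lower half nonnegative, and the upper
  half repeats the natural values of the old lower half.\<close>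

lemma step_copy_gcs:
  "step (copy_gcs N) (nat_valuation N \<mu>) a \<nu> \<longleftrightarrow>
     a = 0 \<and> (\<exists>\<mu>'. \<nu> = nat_valuation N \<mu>' \<and> (\<forall>j<N. \<mu>' (N + j) = \<mu> j))"
proof
  assume "step (copy_gcs N) (nat_valuation N \<mu>) a \<nu>"
  then have a: "a = 0" and \<nu>: "\<nu> \<in> {..<2 * N} \<rightarrow>\<^sub>E UNIV"
    and *: "\<And>j. j < N \<Longrightarrow> 0 \<le> \<nu> j \<and> \<nu> (N + j) = int (\<mu> j)"
    by (simp_all add: step_def valuations_def constraint_sat_copy_constraint)
  have nonneg: "0 \<le> \<nu> x" if "x < 2 * N" for x
    using *[of x] *[of "x - N"] that by (cases "x < N") auto
  then have "\<nu> = nat_valuation N (\<lambda>x. nat (\<nu> x))"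
    using \<nu> by (auto simp: nat_valuation_def PiE_def extensional_def fun_eq_iff)
  with a * show "a = 0 \<and> (\<exists>\<mu>'. \<nu> = nat_valuation N \<mu>' \<and> (\<forall>j<N. \<mu>' (N + j) = \<mu> j))"
    by (intro conjI exI[of _ "\<lambda>x. nat (\<nu> x)"]) auto
qed (auto simp: step_def constraint_sat_copy_constraint)

lemma nat_valuation_Diamond:
  "nat_valuation N \<mu> \<in> sem (copy_gcs N) (Diamond 0 \<psi>) \<longleftrightarrow>
     (\<exists>\<mu>'. (\<forall>j<N. \<mu>' (N + j) = \<mu> j) \<and> nat_valuation N \<mu>' \<in> sem (copy_gcs N) \<psi>)"
  by (auto simp: step_copy_gcs)

text \<open>\<open>EG\<close> tests its body already in the current state, whose upper half need not
  hold the values of a predecessor. The leading \<open>Diamond\<close> moves to a state that stores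
  \<mu>, so the body is tested only from \<open>\<rho> 1\<close> on.\<close>

lemma nat_valuation_Diamond_EG:
  "nat_valuation N \<mu> \<in> sem (copy_gcs N) (Diamond 0 (EG \<psi>)) \<longleftrightarrow>
     (\<exists>\<rho>. \<rho> 0 = \<mu> \<and> (\<forall>i. (\<forall>j<N. \<rho> (Suc i) (N + j) = \<rho> i j) \<and>
        nat_valuation N (\<rho> (Suc i)) \<in> sem (copy_gcs N) \<psi>))" (is "?L \<longleftrightarrow> ?R")
proof
  assume ?L
  then obtain \<mu>1 \<pi> \<alpha> where \<mu>1: "\<forall>j<N. \<mu>1 (N + j) = \<mu> j" and 0: "\<pi> 0 = nat_valuation N \<mu>1"
    and "\<forall>i. step (copy_gcs N) (\<pi> i) (\<alpha> i) (\<pi> (Suc i)) \<and> \<pi> i \<in> sem (copy_gcs N) \<psi>"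
    unfolding nat_valuation_Diamond by auto
  then have st: "\<And>i. step (copy_gcs N) (\<pi> i) (\<alpha> i) (\<pi> (Suc i))"
    and \<psi>: "\<And>i. \<pi> i \<in> sem (copy_gcs N) \<psi>" by blast+
  \<comment> \<open>\<open>EG\<close> ranges over paths of integer valuations, so naturalness has to
    be propagated along the path.\<close>
  have "\<exists>\<mu>'. \<pi> i = nat_valuation N \<mu>'" for i
  proof (induction i)
    case (Suc i)
    then show ?case using st[of i] by (auto simp: step_copy_gcs)
  qed (use 0 in blast)
  then obtain \<sigma> where \<sigma>: "\<And>i. \<pi> i = nat_valuation N (\<sigma> i)" by metis
  \<comment> \<open>The representatives \<open>\<sigma> i\<close> are determined only below
    \<open>2 * N\<close>.\<close>
  have eqD: "\<mu>' x = \<mu>'' x" if "nat_valuation N \<mu>' = nat_valuation N \<mu>''" "x < 2 * N" for \<mu>' \<mu>'' x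
    using fun_cong[OF that(1), of x] that(2) by simp
  have S: "\<sigma> (Suc i) (N + j) = \<sigma> i j" if "j < N" for i j
  proof -
    obtain \<mu>' where "nat_valuation N (\<sigma> (Suc i)) = nat_valuation N \<mu>'"
      and "\<forall>j<N. \<mu>' (N + j) = \<sigma> i j"
      using st[of i] unfolding \<sigma> step_copy_gcs by blast
    then show ?thesis using eqD[of "\<sigma> (Suc i)" \<mu>' "N + j"] that by simp
  qed
  have Z: "\<sigma> 0 (N + j) = \<mu> j" if "j < N" for j
    using eqD[of "\<sigma> 0" \<mu>1 "N + j"] \<sigma>[of 0] 0 \<mu>1 that by simp
  \<comment> \<open>The path found for \<open>EG\<close> starts at a successor of \<mu>, so \<mu> is
    put in front of it.\<close>
  show ?R
    using S Z \<psi> unfolding \<sigma>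
    by (intro exI[of _ "case_nat \<mu> \<sigma>"]) (auto split: nat.split)
next
  assume ?R
  then obtain \<rho> where \<rho>: "\<rho> 0 = \<mu>" "\<And>i j. j < N \<Longrightarrow> \<rho> (Suc i) (N + j) = \<rho> i j"
    "\<And>i. nat_valuation N (\<rho> (Suc i)) \<in> sem (copy_gcs N) \<psi>" by blast
  then have "step (copy_gcs N) (nat_valuation N (\<rho> (Suc i))) 0 (nat_valuation N (\<rho> (Suc (Suc i))))"
    for i unfolding step_copy_gcs by blast
  with \<rho>(3) have "nat_valuation N (\<rho> 1) \<in> sem (copy_gcs N) (EG \<psi>)"
    unfolding sem.simps mem_Collect_eq
    by (intro exI[of _ "\<lambda>i. nat_valuation N (\<rho> (Suc i))"] exI[of _ "\<lambda>_. 0"]) simp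
  with \<rho> show ?L
    unfolding nat_valuation_Diamond by (metis One_nat_def)
qed

section \<open>Definable relations\<close>

text \<open>Nothing is demanded on valuations with negative entries, which no path from a natural
  valuation reaches.\<close>

definition expresses :: "nat \<Rightarrow> eg_formula \<Rightarrow> ((nat \<Rightarrow> nat) \<Rightarrow> bool) \<Rightarrow> bool" where
  "expresses N \<phi> R \<longleftrightarrow> formula_over (copy_gcs N) \<phi> \<and>
     (\<forall>\<mu>. nat_valuation N \<mu> \<in> sem (copy_gcs N) \<phi> \<longleftrightarrow> R \<mu>)"

lemma expresses_TT: "expresses N TT (\<lambda>_. True)"
  by (simp add: expresses_def)

lemma expresses_Neg: "expresses N \<phi> R \<Longrightarrow> expresses N (Neg \<phi>) (\<lambda>\<mu>. \<not> R \<mu>)"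
  by (simp add: expresses_def)

lemma expresses_Conj:
  "expresses N \<phi> R \<Longrightarrow> expresses N \<psi> S \<Longrightarrow> expresses N (Conj \<phi> \<psi>) (\<lambda>\<mu>. R \<mu> \<and> S \<mu>)"
  by (simp add: expresses_def)

lemma expresses_le:
  "x < 2 * N \<Longrightarrow> y < 2 * N \<Longrightarrow>
    expresses N (Clause (Gap (Var y) (Var x) (int c))) (\<lambda>\<mu>. \<mu> x + c \<le> \<mu> y)"
  by (auto simp: expresses_def)

text \<open>The system has the single constant 0, so the bound goes into the number of the clause.
  It is negative there, which formulas allow.\<close>

lemma expresses_le_const:
  "x < 2 * N \<Longrightarrow> expresses N (Clause (Gap (Const 0) (Var x) (- int c))) (\<lambda>\<mu>. \<mu> x \<le> c)"
  by (auto simp: expresses_def)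

text \<open>\<open>(j, s, c)\<close> stands for the assignment \<open>j := s + c\<close>.\<close>

type_synonym update = "(nat \<times> nat \<times> nat) list"

text \<open>A variable without a triple is unconstrained, so a step may guess its new value.\<close>

definition updates :: "update \<Rightarrow> (nat \<Rightarrow> nat) \<Rightarrow> (nat \<Rightarrow> nat) \<Rightarrow> bool" where
  "updates us \<mu> \<mu>' \<longleftrightarrow> (\<forall>(j, s, c)\<in>set us. \<mu>' j = \<mu> s + c)"

text \<open>The test is made after a step, when the old value of \<open>s\<close> is found in
  \<open>N + s\<close>. Equality is the clause with bound \<open>c\<close> together with the negated
  clause with bound \<open>c + 1\<close>.\<close>

lemma expresses_updates:
  assumes "\<forall>(j, s, c)\<in>set us. j < N \<and> s < N"
  shows "\<exists>\<phi>. expresses N \<phi> (\<lambda>\<mu>. updates us (\<lambda>x. \<mu> (N + x)) \<mu>)"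
  using assms
proof (induction us)
  case Nil
  then show ?case using expresses_TT by (auto simp: updates_def)
next
  case (Cons u us)
  obtain j s c where u: "u = (j, s, c)" by (cases u)
  obtain \<phi> where \<phi>: "expresses N \<phi> (\<lambda>\<mu>. updates us (\<lambda>x. \<mu> (N + x)) \<mu>)"
    using Cons by auto
  have lt: "j < 2 * N" "N + s < 2 * N" using Cons.prems u by auto
  let ?ge = "Clause (Gap (Var j) (Var (N + s)) (int c))"
  let ?gt = "Clause (Gap (Var j) (Var (N + s)) (int (Suc c)))"
  have "(\<mu> (N + s) + c \<le> \<mu> j \<and> \<not> \<mu> (N + s) + Suc c \<le> \<mu> j) \<and> updates us (\<lambda>x. \<mu> (N + x)) \<mu>
      \<longleftrightarrow> updates (u # us) (\<lambda>x. \<mu> (N + x)) \<mu>" for \<mu>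
    by (auto simp: updates_def u)
  moreover have "expresses N (Conj (Conj ?ge (Neg ?gt)) \<phi>)
      (\<lambda>\<mu>. (\<mu> (N + s) + c \<le> \<mu> j \<and> \<not> \<mu> (N + s) + Suc c \<le> \<mu> j) \<and>
         updates us (\<lambda>x. \<mu> (N + x)) \<mu>)"
    by (intro expresses_Conj expresses_Neg expresses_le lt \<phi>)
  ultimately show ?case by auto
qed

text \<open>
  The formula depends on \<open>N\<close>, since the old value of \<open>j\<close> is stored in \<open>N + j\<close>, and only
  large \<open>N\<close> leave room for the scratch variables of all nested quantifiers.
\<close>

definition definable :: "nat \<Rightarrow> ((nat \<Rightarrow> nat) \<Rightarrow> bool) \<Rightarrow> bool" where
  "definable m R \<longleftrightarrow> (\<forall>\<mu> \<mu>'. (\<forall>j<m. \<mu> j = \<mu>' j) \<longrightarrow> R \<mu> = R \<mu>') \<and>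
     (\<exists>n. \<forall>N\<ge>n. \<exists>\<phi>. expresses N \<phi> R)"

lemma definableD: "definable m R \<Longrightarrow> (\<And>j. j < m \<Longrightarrow> \<mu> j = \<mu>' j) \<Longrightarrow> R \<mu> = R \<mu>'"
  by (auto simp: definable_def)

lemma definable_expresses: "definable m R \<Longrightarrow> \<exists>n. \<forall>N\<ge>n. \<exists>\<phi>. expresses N \<phi> R"
  by (simp add: definable_def)

lemma definableI:
  assumes "\<And>\<mu> \<mu>'. (\<And>j. j < m \<Longrightarrow> \<mu> j = \<mu>' j) \<Longrightarrow> R \<mu> \<Longrightarrow> R \<mu>'"
    and "\<And>N. n \<le> N \<Longrightarrow> \<exists>\<phi>. expresses N \<phi> R"
  shows "definable m R"
  unfolding definable_def
proof (intro conjI allI impI)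
  fix \<mu> \<mu>' assume "\<forall>j<m. \<mu> j = (\<mu>' j :: nat)"
  then show "R \<mu> = R \<mu>'" using assms(1)[of \<mu> \<mu>'] assms(1)[of \<mu>' \<mu>] by auto
qed (use assms(2) in blast)

section \<open>Boolean closure and atomic comparisons\<close>

lemma definable_True: "definable m (\<lambda>_. True)"
  by (rule definableI[where n = 0]) (use expresses_TT in auto)

lemma definable_not:
  assumes "definable m R"
  shows "definable m (\<lambda>\<mu>. \<not> R \<mu>)"
proof -
  obtain n where n: "\<forall>N\<ge>n. \<exists>\<phi>. expresses N \<phi> R"
    using definable_expresses[OF assms] ..
  show ?thesis
  proof (rule definableI)
    show "\<exists>\<phi>. expresses N \<phi> (\<lambda>\<mu>. \<not> R \<mu>)" if "n \<le> N" for N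
      using n that by (auto dest: expresses_Neg)
  qed (use definableD[OF assms] in blast)
qed

lemma definable_False: "definable m (\<lambda>_. False)"
  using definable_not[OF definable_True] by simp

lemma definable_conj:
  assumes "definable m R" "definable m S"
  shows "definable m (\<lambda>\<mu>. R \<mu> \<and> S \<mu>)"
proof -
  obtain n1 where n1: "\<forall>N\<ge>n1. \<exists>\<phi>. expresses N \<phi> R"
    using definable_expresses[OF assms(1)] ..
  obtain n2 where n2: "\<forall>N\<ge>n2. \<exists>\<phi>. expresses N \<phi> S"
    using definable_expresses[OF assms(2)] ..
  show ?thesis
  proof (rule definableI)
    fix N assume "max n1 n2 \<le> N"
    then obtain \<phi> \<psi> where "expresses N \<phi> R" "expresses N \<psi> S" using n1 n2 by fastforce
    then have "expresses N (Conj \<phi> \<psi>) (\<lambda>\<mu>. R \<mu> \<and> S \<mu>)" by (rule expresses_Conj)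
    then show "\<exists>\<phi>. expresses N \<phi> (\<lambda>\<mu>. R \<mu> \<and> S \<mu>)" ..
  qed (use definableD[OF assms(1)] definableD[OF assms(2)] in blast)
qed

lemma definable_imp:
  "definable m R \<Longrightarrow> definable m S \<Longrightarrow> definable m (\<lambda>\<mu>. R \<mu> \<longrightarrow> S \<mu>)"
  using definable_not[OF definable_conj[of m R "\<lambda>\<mu>. \<not> S \<mu>"]] definable_not[of m S] by simp

lemma definable_all_less:
  fixes l :: nat
  shows "(\<And>i. i < l \<Longrightarrow> definable m (R i)) \<Longrightarrow> definable m (\<lambda>\<mu>. \<forall>i<l. R i \<mu>)"
proof (induction l)
  case 0
  then show ?case by (simp add: definable_True)
next
  case (Suc l)
  then have "definable m (\<lambda>\<mu>. R l \<mu> \<and> (\<forall>i<l. R i \<mu>))"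
    by (intro definable_conj) auto
  then show ?case by (simp add: All_less_Suc)
qed

lemma definable_le: "x < m \<Longrightarrow> y < m \<Longrightarrow> definable m (\<lambda>\<mu>. \<mu> x + c \<le> \<mu> y)"
  by (rule definableI[where n = m], force,
      rule exI[of _ "Clause (Gap (Var y) (Var x) (int c))"], rule expresses_le, auto)

lemma definable_le_const: "x < m \<Longrightarrow> definable m (\<lambda>\<mu>. \<mu> x \<le> c)"
  by (rule definableI[where n = m], force,
      rule exI[of _ "Clause (Gap (Const 0) (Var x) (- int c))"], rule expresses_le_const, auto)

lemma definable_less: "x < m \<Longrightarrow> y < m \<Longrightarrow> definable m (\<lambda>\<mu>. \<mu> x < \<mu> y)"
  using definable_le[of x m y 1] by (simp add: Suc_le_eq)

lemma definable_eq:
  assumes "x < m" "y < m"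
  shows "definable m (\<lambda>\<mu>. \<mu> y = \<mu> x + c)"
proof -
  have "(\<lambda>\<mu>. \<mu> y = \<mu> x + c) = (\<lambda>\<mu>. \<mu> x + c \<le> \<mu> y \<and> \<not> \<mu> x + Suc c \<le> \<mu> y)"
    by auto
  then show ?thesis
    by (simp only:) (intro definable_conj definable_not definable_le assms)
qed

lemma definable_pos: "x < m \<Longrightarrow> definable m (\<lambda>\<mu>. 0 < \<mu> x)"
  using definable_not[OF definable_le_const[of x m 0]] by simp

lemma definable_eq_0: "x < m \<Longrightarrow> definable m (\<lambda>\<mu>. \<mu> x = 0)"
  using definable_le_const[of x m 0] by simp

text \<open>A step that keeps the first \<open>k\<close> variables chooses the other ones freely, so
  one \<open>Diamond\<close> acts as a block of existential quantifiers.\<close>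

lemma definable_ex:
  assumes R: "definable m R"
  shows "definable k (\<lambda>\<mu>. \<exists>\<mu>'. (\<forall>j<k. \<mu>' j = \<mu> j) \<and> R \<mu>')"
proof -
  obtain n where n: "\<forall>N\<ge>n. \<exists>\<phi>. expresses N \<phi> R"
    using definable_expresses[OF R] ..
  define us where "us = map (\<lambda>j. (j, j, 0::nat)) [0..<k]"
  have us: "updates us \<mu> \<mu>' \<longleftrightarrow> (\<forall>j<k. \<mu>' j = \<mu> j)" for \<mu> \<mu>'
    by (auto simp: us_def updates_def)
  show ?thesis
  proof (rule definableI)
    fix N assume N: "max n (max k m) \<le> N"
    then obtain \<phi> where \<phi>: "expresses N \<phi> R" using n by auto
    obtain \<tau> where \<tau>: "expresses N \<tau> (\<lambda>\<mu>. updates us (\<lambda>x. \<mu> (N + x)) \<mu>)"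
      using expresses_updates[of us N] N by (auto simp: us_def)
    have "expresses N (Diamond 0 (Conj \<tau> \<phi>)) (\<lambda>\<mu>. \<exists>\<mu>'. (\<forall>j<k. \<mu>' j = \<mu> j) \<and> R \<mu>')"
      unfolding expresses_def nat_valuation_Diamond
    proof (intro conjI allI iffI)
      fix \<mu> assume "\<exists>\<mu>'. (\<forall>j<N. \<mu>' (N + j) = \<mu> j) \<and>
        nat_valuation N \<mu>' \<in> sem (copy_gcs N) (Conj \<tau> \<phi>)"
      then obtain \<mu>' where "\<forall>j<N. \<mu>' (N + j) = \<mu> j" "R \<mu>'" "\<forall>j<k. \<mu>' j = \<mu>' (N + j)"
        using \<phi> \<tau> by (auto simp: expresses_def us)
      then show "\<exists>\<mu>'. (\<forall>j<k. \<mu>' j = \<mu> j) \<and> R \<mu>'" using N by auto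
    next
      fix \<mu> assume "\<exists>\<mu>'. (\<forall>j<k. \<mu>' j = \<mu> j) \<and> R \<mu>'"
      then obtain \<mu>' where \<mu>': "\<forall>j<k. \<mu>' j = \<mu> j" "R \<mu>'" by blast
      \<comment> \<open>The upper half has to store \<mu>. Overwriting it does not affect
        \<open>R\<close>, which depends only on the variables below \<open>m\<close>, and
        \<open>m\<close> is at most \<open>N\<close>.\<close>
      define \<mu>'' where "\<mu>'' = (\<lambda>j. if j < N then \<mu>' j else \<mu> (j - N))"
      have "R \<mu>''"
        using \<mu>'(2) definableD[OF R, of \<mu>'' \<mu>'] N by (simp add: \<mu>''_def)
      moreover have "updates us (\<lambda>x. \<mu>'' (N + x)) \<mu>''"
        using \<mu>' N by (simp add: us \<mu>''_def)
      ultimately show "\<exists>\<mu>'. (\<forall>j<N. \<mu>' (N + j) = \<mu> j) \<and>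
        nat_valuation N \<mu>' \<in> sem (copy_gcs N) (Conj \<tau> \<phi>)"
        using \<phi> \<tau> by (intro exI[of _ \<mu>'']) (auto simp: expresses_def \<mu>''_def)
    qed (use \<phi> \<tau> in \<open>auto simp: expresses_def\<close>)
    then show "\<exists>\<phi>. expresses N \<phi> (\<lambda>\<mu>. \<exists>\<mu>'. (\<forall>j<k. \<mu>' j = \<mu> j) \<and> R \<mu>')" ..
  qed metis
qed

text \<open>An infinite run of updates is a path of the copying system on which every step passes
  the test from \<open>expresses_updates\<close>.\<close>

lemma definable_iterate:
  assumes R: "definable m R" and us: "\<forall>(j, s, c)\<in>set us. j < m \<and> s < m"
  shows "definable m (\<lambda>\<mu>. \<exists>\<rho>. \<rho> 0 = \<mu> \<and> (\<forall>i. R (\<rho> i) \<and> updates us (\<rho> i) (\<rho> (Suc i))))"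
    (is "definable m ?S")
proof -
  obtain n where n: "\<forall>N\<ge>n. \<exists>\<phi>. expresses N \<phi> R"
    using definable_expresses[OF R] ..
  have upd: "updates us \<mu> \<mu>' = updates us \<nu> \<nu>'"
    if "\<And>j. j < m \<Longrightarrow> \<mu> j = \<nu> j" "\<And>j. j < m \<Longrightarrow> \<mu>' j = \<nu>' j" for \<mu> \<mu>' \<nu> \<nu>'
    unfolding updates_def using us that by (intro ball_cong) auto
  show ?thesis
  proof (rule definableI)
    fix \<mu> \<mu>' :: "nat \<Rightarrow> nat" assume eq: "\<And>j. j < m \<Longrightarrow> \<mu> j = \<mu>' j" and "?S \<mu>"
    then obtain \<rho> where \<rho>: "\<rho> 0 = \<mu>" "\<And>i. R (\<rho> i)" "\<And>i. updates us (\<rho> i) (\<rho> (Suc i))" by blast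
    \<comment> \<open>The run starts in \<mu> itself, so only its first state has to be
      exchanged.\<close>
    have "R ((\<rho>(0 := \<mu>')) i)" for i
      using \<rho> definableD[OF R, of \<mu> \<mu>'] eq by (metis fun_upd_apply)
    moreover have "updates us ((\<rho>(0 := \<mu>')) i) ((\<rho>(0 := \<mu>')) (Suc i))" for i
      using \<rho>(1) \<rho>(3)[of i] upd[of \<mu> \<mu>' "\<rho> 1" "\<rho> 1"] eq by (cases i) auto
    ultimately show "?S \<mu>'" by (intro exI[of _ "\<rho>(0 := \<mu>')"]) auto
  next
    fix N assume N: "max n m \<le> N"
    then obtain \<phi> where \<phi>: "expresses N \<phi> R" using n by auto
    obtain \<tau> where \<tau>: "expresses N \<tau> (\<lambda>\<mu>. updates us (\<lambda>x. \<mu> (N + x)) \<mu>)"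
      using expresses_updates[of us N] us N by fastforce
    \<comment> \<open>The outer \<phi> tests state 0, which \<open>EG\<close> under
      \<open>Diamond\<close> skips; \<tau> compares each later state with the stored values of its
      predecessor.\<close>
    have "nat_valuation N \<mu> \<in> sem (copy_gcs N) (Conj \<phi> (Diamond 0 (EG (Conj \<phi> \<tau>)))) \<longleftrightarrow>
        R \<mu> \<and> (\<exists>\<rho>. \<rho> 0 = \<mu> \<and> (\<forall>i. (\<forall>j<N. \<rho> (Suc i) (N + j) = \<rho> i j) \<and> R (\<rho> (Suc i)) \<and>
          updates us (\<lambda>x. \<rho> (Suc i) (N + x)) (\<rho> (Suc i))))" (is "_ \<longleftrightarrow> ?S' \<mu>") for \<mu>
      using \<phi> \<tau>
      by (simp only: sem.simps(4) Int_iff nat_valuation_Diamond_EG expresses_def)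
    moreover have "?S' \<mu> \<longleftrightarrow> ?S \<mu>" for \<mu>
    proof
      assume "?S' \<mu>"
      then obtain \<rho> where "R \<mu>" and \<rho>: "\<rho> 0 = \<mu>" "\<And>i j. j < N \<Longrightarrow> \<rho> (Suc i) (N + j) = \<rho> i j"
        "\<And>i. R (\<rho> (Suc i))" "\<And>i. updates us (\<lambda>x. \<rho> (Suc i) (N + x)) (\<rho> (Suc i))" by blast
      have "R (\<rho> i)" for i using \<open>R \<mu>\<close> \<rho> by (cases i) auto
      moreover have "updates us (\<rho> i) (\<rho> (Suc i))" for i
        using \<rho>(4)[of i] upd[of "\<lambda>x. \<rho> (Suc i) (N + x)" "\<rho> i"] \<rho>(2) N by simp
      ultimately show "?S \<mu>" using \<rho>(1) by blast
    next
      assume "?S \<mu>"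
      then obtain \<rho> where \<rho>: "\<rho> 0 = \<mu>" "\<And>i. R (\<rho> i)" "\<And>i. updates us (\<rho> i) (\<rho> (Suc i))" by blast
      \<comment> \<open>The given run need not store predecessors, so the upper half of every later
        state is overwritten with the values of the state before it.\<close>
      define \<sigma> where "\<sigma> = case_nat \<mu> (\<lambda>i x. if x < N then \<rho> (Suc i) x else \<rho> i (x - N))"
      have \<sigma>: "\<sigma> i x = \<rho> i x" if "x < N" for i x
        using that \<rho>(1) by (simp add: \<sigma>_def split: nat.split)
      have old: "\<sigma> (Suc i) (N + x) = \<rho> i x" for i x by (simp add: \<sigma>_def)
      have "R (\<sigma> i)" for i
        using \<rho>(2)[of i] definableD[OF R, of "\<sigma> i" "\<rho> i"] \<sigma> N by simp
      moreover have "updates us (\<lambda>x. \<sigma> (Suc i) (N + x)) (\<sigma> (Suc i))" for i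
        using \<rho>(3)[of i] upd[of "\<lambda>x. \<sigma> (Suc i) (N + x)" "\<rho> i" "\<sigma> (Suc i)" "\<rho> (Suc i)"] \<sigma> old N
        by simp
      moreover have "\<sigma> 0 = \<mu>" by (simp add: \<sigma>_def)
      moreover have "\<sigma> (Suc i) (N + j) = \<sigma> i j" if "j < N" for i j
        using \<sigma> old that by simp
      ultimately show "?S' \<mu>" by metis
    qed
    ultimately have "expresses N (Conj \<phi> (Diamond 0 (EG (Conj \<phi> \<tau>)))) ?S"
      using \<phi> \<tau> unfolding expresses_def by (auto simp del: sem.simps)
    then show "\<exists>\<phi>. expresses N \<phi> ?S" ..
  qed
qed

section \<open>Graphs of partial recursive functions are definable\<close>

lemma computes_Zero_iff: "computes Zero xs y \<longleftrightarrow> y = 0"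
  by (auto elim: computes.cases intro: computes.Zero)

lemma computes_Succ_iff: "computes Succ xs y \<longleftrightarrow> (\<exists>x. xs = [x] \<and> y = Suc x)"
  by (auto elim: computes.cases intro: computes.Succ)

lemma computes_Proj_iff: "computes (Proj i) xs y \<longleftrightarrow> i < length xs \<and> y = xs ! i"
  by (auto elim: computes.cases intro: computes.Proj)

lemma computes_Comp_iff:
  "computes (Comp f gs) xs z \<longleftrightarrow> (\<exists>ys. list_all2 (\<lambda>g y. computes g xs y) gs ys \<and> computes f ys z)"
proof
  assume "computes (Comp f gs) xs z"
  then show "\<exists>ys. list_all2 (\<lambda>g y. computes g xs y) gs ys \<and> computes f ys z"
    by (cases rule: computes.cases) auto
qed (auto intro: computes.Comp)

lemma computes_Mu_iff:
  "computes (Mu f) xs n \<longleftrightarrow>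
     computes f (n # xs) 0 \<and> (\<forall>m<n. \<exists>y>0. computes f (m # xs) y)"
proof
  assume "computes (Mu f) xs n"
  then show "computes f (n # xs) 0 \<and> (\<forall>m<n. \<exists>y>0. computes f (m # xs) y)"
    by (cases rule: computes.cases) auto
qed (auto intro!: computes.Mu simp: gr0_conv_Suc)

lemma not_computes_PrimRec_Nil: "\<not> computes (PrimRec f g) [] y"
  by (auto elim: computes.cases)

text \<open>The recursion is unfolded into the sequence \<open>r\<close> of accumulator values, the
  form that a run of \<open>definable_iterate\<close> can follow.\<close>

lemma computes_PrimRec_iff:
  "computes (PrimRec f g) (n # xs) y \<longleftrightarrow>
     (\<exists>r. computes f xs (r 0) \<and> (\<forall>i<n. computes g (i # r i # xs) (r (Suc i))) \<and> r n = y)"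
proof (induction n arbitrary: y)
  case 0
  have "computes (PrimRec f g) (0 # xs) y \<longleftrightarrow> computes f xs y"
    by (auto elim: computes.cases intro: computes.PrimRec_0)
  then show ?case by auto
next
  case (Suc n)
  have "computes (PrimRec f g) (Suc n # xs) y \<longleftrightarrow>
      (\<exists>z. computes (PrimRec f g) (n # xs) z \<and> computes g (n # z # xs) y)"
  proof
    assume "computes (PrimRec f g) (Suc n # xs) y"
    then show "\<exists>z. computes (PrimRec f g) (n # xs) z \<and> computes g (n # z # xs) y"
      by (cases rule: computes.cases) auto
  qed (auto intro: computes.PrimRec_Suc)
  also have "\<dots> \<longleftrightarrow> (\<exists>r. computes f xs (r 0) \<and>
      (\<forall>i<Suc n. computes g (i # r i # xs) (r (Suc i))) \<and> r (Suc n) = y)"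
  proof
    assume "\<exists>z. computes (PrimRec f g) (n # xs) z \<and> computes g (n # z # xs) y"
    then obtain r where "computes f xs (r 0)" "\<forall>i<n. computes g (i # r i # xs) (r (Suc i))"
      "computes g (n # r n # xs) y"
      using Suc by auto
    then show "\<exists>r. computes f xs (r 0) \<and>
      (\<forall>i<Suc n. computes g (i # r i # xs) (r (Suc i))) \<and> r (Suc n) = y"
      by (intro exI[of _ "r(Suc n := y)"]) (auto simp: less_Suc_eq)
  qed (use Suc in force)
  finally show ?case .
qed

text \<open>The intermediate results are guessed in the fresh variables from \<open>k\<close> to
  \<open>k + l - 1\<close>. The subprograms then live over more variables, which is why the
  hypotheses range over all \<open>k\<close>.\<close>

lemma definable_Comp:
  assumes f: "\<And>k xs y. set xs \<subseteq> {..<k} \<Longrightarrow> y < k \<Longrightarrow> definable k (\<lambda>\<mu>. computes f (map \<mu> xs) (\<mu> y))"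
    and gs: "\<And>g k xs y. g \<in> set gs \<Longrightarrow> set xs \<subseteq> {..<k} \<Longrightarrow> y < k \<Longrightarrow>
      definable k (\<lambda>\<mu>. computes g (map \<mu> xs) (\<mu> y))"
    and xs: "set xs \<subseteq> {..<k}" and y: "y < k"
  shows "definable k (\<lambda>\<mu>. computes (Comp f gs) (map \<mu> xs) (\<mu> y))"
proof -
  define l where "l = length gs"
  let ?R = "\<lambda>\<mu>. (\<forall>i<l. computes (gs ! i) (map \<mu> xs) (\<mu> (k + i))) \<and>
      computes f (map \<mu> [k..<k + l]) (\<mu> y)"
  have "definable (k + l) ?R"
    using xs y by (intro definable_conj definable_all_less f gs) (auto simp: l_def)
  then have "definable k (\<lambda>\<mu>. \<exists>\<mu>'. (\<forall>j<k. \<mu>' j = \<mu> j) \<and> ?R \<mu>')"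
    by (rule definable_ex)
  moreover have "(\<exists>\<mu>'. (\<forall>j<k. \<mu>' j = \<mu> j) \<and> ?R \<mu>') \<longleftrightarrow>
      computes (Comp f gs) (map \<mu> xs) (\<mu> y)" for \<mu>
  proof
    assume "\<exists>\<mu>'. (\<forall>j<k. \<mu>' j = \<mu> j) \<and> ?R \<mu>'"
    then obtain \<mu>' where \<mu>': "\<forall>j<k. \<mu>' j = \<mu> j" "?R \<mu>'" by blast
    then have "map \<mu>' xs = map \<mu> xs" "\<mu>' y = \<mu> y" using xs y by auto
    with \<mu>' show "computes (Comp f gs) (map \<mu> xs) (\<mu> y)"
      unfolding computes_Comp_iff
      by (intro exI[of _ "map \<mu>' [k..<k + l]"]) (auto simp: list_all2_conv_all_nth l_def)
  next
    assume "computes (Comp f gs) (map \<mu> xs) (\<mu> y)"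
    then obtain ys where ys: "length ys = l" "\<forall>i<l. computes (gs ! i) (map \<mu> xs) (ys ! i)"
      "computes f ys (\<mu> y)"
      by (auto simp: computes_Comp_iff list_all2_conv_all_nth l_def)
    define \<mu>' where "\<mu>' = (\<lambda>j. if j < k then \<mu> j else ys ! (j - k))"
    have "map \<mu>' xs = map \<mu> xs" "map \<mu>' [k..<k + l] = ys" "\<mu>' y = \<mu> y"
      using xs y ys(1) by (auto simp: \<mu>'_def intro: nth_equalityI)
    then show "\<exists>\<mu>'. (\<forall>j<k. \<mu>' j = \<mu> j) \<and> ?R \<mu>'"
      using ys by (intro exI[of _ \<mu>'] conjI) (simp_all only:, auto simp: \<mu>'_def)
  qed
  ultimately show ?thesis by simp
qed

lemma definable_PrimRec:
  assumes f: "\<And>k xs y. set xs \<subseteq> {..<k} \<Longrightarrow> y < k \<Longrightarrow> definable k (\<lambda>\<mu>. computes f (map \<mu> xs) (\<mu> y))"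
    and g: "\<And>k xs y. set xs \<subseteq> {..<k} \<Longrightarrow> y < k \<Longrightarrow> definable k (\<lambda>\<mu>. computes g (map \<mu> xs) (\<mu> y))"
    and xs: "set xs \<subseteq> {..<k}" and n: "n < k" and y: "y < k"
  shows "definable k (\<lambda>\<mu>. computes (PrimRec f g) (map \<mu> (n # xs)) (\<mu> y))"
proof -
  txt \<open>
    Variable \<open>k\<close> is the loop counter, \<open>k + 1\<close> the accumulator and \<open>k + 2\<close> a guess of the next
    accumulator, which makes the recursive call to \<open>g\<close> a condition on a single state.
    The loop never stops, but nothing is required once the counter has passed \<open>n\<close>.
  \<close>
  let ?I = "\<lambda>\<mu>. (\<mu> k < \<mu> n \<longrightarrow> computes g (map \<mu> (k # (k + 1) # xs)) (\<mu> (k + 2))) \<and>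
      (\<mu> k = \<mu> n + 0 \<longrightarrow> \<mu> y = \<mu> (k + 1) + 0)"
  \<comment> \<open>No triple assigns \<open>k + 2\<close>, so the guess is made anew in every
    step.\<close>
  define us :: update where "us = (k, k, 1) # (k + 1, k + 2, 0) # map (\<lambda>j. (j, j, 0)) [0..<k]"
  let ?L = "\<lambda>\<mu>. \<exists>\<rho>. \<rho> 0 = \<mu> \<and> (\<forall>i. ?I (\<rho> i) \<and> updates us (\<rho> i) (\<rho> (Suc i)))"
  let ?R = "\<lambda>\<mu>. (\<mu> k = 0 \<and> computes f (map \<mu> xs) (\<mu> (k + 1))) \<and> ?L \<mu>"
  have us: "updates us \<mu> \<mu>' \<longleftrightarrow>
      \<mu>' k = Suc (\<mu> k) \<and> \<mu>' (k + 1) = \<mu> (k + 2) \<and> (\<forall>j<k. \<mu>' j = \<mu> j)" for \<mu> \<mu>'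
    by (auto simp: updates_def us_def)
  \<comment> \<open>The summands \<open>+ 0\<close> in \<open>?I\<close> give its equations the
    shape of \<open>definable_eq\<close>.\<close>
  have "definable (k + 3) ?I"
    using xs n y by (intro definable_conj definable_imp definable_less definable_eq g) auto
  then have "definable (k + 3) ?L"
    by (rule definable_iterate) (auto simp: us_def)
  then have "definable (k + 3) ?R"
    using xs by (intro definable_conj definable_eq_0 f) auto
  then have "definable k (\<lambda>\<mu>. \<exists>\<mu>'. (\<forall>j<k. \<mu>' j = \<mu> j) \<and> ?R \<mu>')"
    by (rule definable_ex)
  moreover have "(\<exists>\<mu>'. (\<forall>j<k. \<mu>' j = \<mu> j) \<and> ?R \<mu>') \<longleftrightarrow>
      computes (PrimRec f g) (map \<mu> (n # xs)) (\<mu> y)" for \<mu>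
  proof
    assume "\<exists>\<mu>'. (\<forall>j<k. \<mu>' j = \<mu> j) \<and> ?R \<mu>'"
    then obtain \<rho> where 0: "\<forall>j<k. \<rho> 0 j = \<mu> j" "\<rho> 0 k = 0" "computes f (map (\<rho> 0) xs) (\<rho> 0 (k + 1))"
      and I: "\<And>i. ?I (\<rho> i)" and u: "\<And>i. updates us (\<rho> i) (\<rho> (Suc i))" by blast
    have inv: "\<rho> i k = i \<and> (\<forall>j<k. \<rho> i j = \<mu> j)" for i
    proof (induction i)
      case (Suc i)
      then show ?case using u[of i] by (auto simp: us)
    qed (use 0 in auto)
    have m: "map (\<rho> i) xs = map \<mu> xs" for i using inv[of i] xs by auto
    have "\<forall>i<\<mu> n. computes g (i # \<rho> i (k + 1) # map \<mu> xs) (\<rho> (Suc i) (k + 1))"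
    proof (intro allI impI)
      fix i assume "i < \<mu> n"
      then show "computes g (i # \<rho> i (k + 1) # map \<mu> xs) (\<rho> (Suc i) (k + 1))"
        using I[of i] inv[of i] u[of i] n m[of i] by (simp add: us)
    qed
    moreover have "\<rho> (\<mu> n) (k + 1) = \<mu> y"
      using I[of "\<mu> n"] inv[of "\<mu> n"] n y by simp
    ultimately show "computes (PrimRec f g) (map \<mu> (n # xs)) (\<mu> y)"
      using 0(3) m[of 0]
      by (auto simp: computes_PrimRec_iff intro!: exI[of _ "\<lambda>i. \<rho> i (k + 1)"])
  next
    assume "computes (PrimRec f g) (map \<mu> (n # xs)) (\<mu> y)"
    then obtain r where r: "computes f (map \<mu> xs) (r 0)"
      "\<forall>i<\<mu> n. computes g (i # r i # map \<mu> xs) (r (Suc i))" "r (\<mu> n) = \<mu> y"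
      by (auto simp: computes_PrimRec_iff)
    \<comment> \<open>The guess in state \<open>i\<close> is the next accumulator value; from
      \<open>i = \<mu> n\<close> on it is arbitrary.\<close>
    define \<rho> where "\<rho> i = \<mu>(k := i, k + 1 := r i, k + 2 := r (Suc i))" for i
    have m: "map (\<rho> i) xs = map \<mu> xs" and \<rho>: "\<rho> i k = i" "\<rho> i (k + 1) = r i"
      "\<rho> i (k + 2) = r (Suc i)" "\<And>j. j < k \<Longrightarrow> \<rho> i j = \<mu> j" for i
      using xs by (auto simp: \<rho>_def)
    have "?I (\<rho> i)" for i
      using r n y by (simp only: list.map m \<rho>) auto
    moreover have "updates us (\<rho> i) (\<rho> (Suc i))" for i
      using \<rho>(4)[of _ i] \<rho>(4)[of _ "Suc i"] by (simp only: us \<rho>(1-3)) simp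
    moreover have "computes f (map (\<rho> 0) xs) (\<rho> 0 (k + 1))"
      using r(1) by (simp only: m \<rho>)
    ultimately show "\<exists>\<mu>'. (\<forall>j<k. \<mu>' j = \<mu> j) \<and> ?R \<mu>'"
      using \<rho>(1)[of 0] \<rho>(4)[of _ 0] by (intro exI[of _ "\<rho> 0"] conjI exI[of _ \<rho>]) auto
  qed
  ultimately show ?thesis by simp
qed

text \<open>Minimality is the absence of a counterexample: by \<open>?B\<close>, a value below
  \<open>\<mu> y\<close>, held in \<open>k\<close>, at which \<open>f\<close> has no positive
  result, be it through result 0 or divergence. In \<open>?A\<close> the variable \<open>k\<close>
  holds 0 because results are read from variables.\<close>

lemma definable_Mu:
  assumes f: "\<And>k xs y. set xs \<subseteq> {..<k} \<Longrightarrow> y < k \<Longrightarrow> definable k (\<lambda>\<mu>. computes f (map \<mu> xs) (\<mu> y))"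
    and xs: "set xs \<subseteq> {..<k}" and y: "y < k"
  shows "definable k (\<lambda>\<mu>. computes (Mu f) (map \<mu> xs) (\<mu> y))"
proof -
  let ?A = "\<lambda>\<mu>. \<exists>\<mu>'. (\<forall>j<k. \<mu>' j = \<mu> j) \<and> (\<mu>' k = 0 \<and> computes f (map \<mu>' (y # xs)) (\<mu>' k))"
  let ?C = "\<lambda>\<mu>. \<exists>\<mu>'. (\<forall>j<Suc k. \<mu>' j = \<mu> j) \<and>
      (0 < \<mu>' (Suc k) \<and> computes f (map \<mu>' (k # xs)) (\<mu>' (Suc k)))"
  let ?B = "\<lambda>\<mu>. \<exists>\<mu>'. (\<forall>j<k. \<mu>' j = \<mu> j) \<and> (\<mu>' k < \<mu>' y \<and> \<not> ?C \<mu>')"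
  have xs': "set xs \<subseteq> {..<Suc k}" "set xs \<subseteq> {..<Suc (Suc k)}" using xs by auto
  have "definable k ?A"
    by (rule definable_ex[of "Suc k"]) (use xs' y in \<open>intro definable_conj definable_eq_0 f; auto\<close>)
  moreover have C: "definable (Suc k) ?C"
    by (rule definable_ex[of "Suc (Suc k)"])
      (use xs' in \<open>intro definable_conj definable_pos f; auto\<close>)
  have "definable k ?B"
    by (rule definable_ex[of "Suc k"], rule definable_conj[OF definable_less definable_not[OF C]])
      (use y in auto)
  ultimately have "definable k (\<lambda>\<mu>. ?A \<mu> \<and> \<not> ?B \<mu>)"
    by (intro definable_conj definable_not)
  moreover have "?A \<mu> \<and> \<not> ?B \<mu> \<longleftrightarrow> computes (Mu f) (map \<mu> xs) (\<mu> y)" for \<mu>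
  proof -
    have map: "map \<mu>' xs = map \<mu>'' xs" if "\<forall>j<k. \<mu>' j = \<mu>'' j" for \<mu>' \<mu>'' :: "nat \<Rightarrow> nat"
      using that xs by auto
    have upd: "map (\<mu>'(j := z)) xs = map \<mu>' xs" if "k \<le> j" for \<mu>' :: "nat \<Rightarrow> nat" and j z
      using that xs by auto
    have A: "?A \<mu> \<longleftrightarrow> computes f (\<mu> y # map \<mu> xs) 0"
    proof
      assume "?A \<mu>"
      then obtain \<mu>' where "\<forall>j<k. \<mu>' j = \<mu> j" "\<mu>' k = 0" "computes f (map \<mu>' (y # xs)) (\<mu>' k)"
        by blast
      then show "computes f (\<mu> y # map \<mu> xs) 0"
        using map[of \<mu>' \<mu>] y by simp
    next
      assume "computes f (\<mu> y # map \<mu> xs) 0"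
      then show "?A \<mu>"
        using y by (intro exI[of _ "\<mu>(k := 0)"]) (simp add: upd)
    qed
    have C: "?C \<mu>' \<longleftrightarrow> (\<exists>z>0. computes f (\<mu>' k # map \<mu>' xs) z)" for \<mu>'
    proof
      assume "?C \<mu>'"
      then obtain \<mu>'' where "\<forall>j<Suc k. \<mu>'' j = \<mu>' j" "0 < \<mu>'' (Suc k)"
        "computes f (map \<mu>'' (k # xs)) (\<mu>'' (Suc k))" by blast
      then show "\<exists>z>0. computes f (\<mu>' k # map \<mu>' xs) z"
        using map[of \<mu>'' \<mu>'] by (intro exI[of _ "\<mu>'' (Suc k)"]) auto
    next
      assume "\<exists>z>0. computes f (\<mu>' k # map \<mu>' xs) z"
      then obtain z where "0 < z" "computes f (\<mu>' k # map \<mu>' xs) z" by blast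
      then show "?C \<mu>'"
        by (intro exI[of _ "\<mu>'(Suc k := z)"]) (simp add: upd)
    qed
    have B: "?B \<mu> \<longleftrightarrow> (\<exists>i<\<mu> y. \<not> (\<exists>z>0. computes f (i # map \<mu> xs) z))"
      unfolding C
    proof
      assume "\<exists>\<mu>'. (\<forall>j<k. \<mu>' j = \<mu> j) \<and>
        (\<mu>' k < \<mu>' y \<and> \<not> (\<exists>z>0. computes f (\<mu>' k # map \<mu>' xs) z))"
      then obtain \<mu>' where "\<forall>j<k. \<mu>' j = \<mu> j" "\<mu>' k < \<mu>' y"
        "\<not> (\<exists>z>0. computes f (\<mu>' k # map \<mu>' xs) z)" by blast
      then show "\<exists>i<\<mu> y. \<not> (\<exists>z>0. computes f (i # map \<mu> xs) z)"
        using map[of \<mu>' \<mu>] y by (intro exI[of _ "\<mu>' k"]) auto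
    next
      assume "\<exists>i<\<mu> y. \<not> (\<exists>z>0. computes f (i # map \<mu> xs) z)"
      then obtain i where "i < \<mu> y" "\<not> (\<exists>z>0. computes f (i # map \<mu> xs) z)" by blast
      then show "\<exists>\<mu>'. (\<forall>j<k. \<mu>' j = \<mu> j) \<and>
        (\<mu>' k < \<mu>' y \<and> \<not> (\<exists>z>0. computes f (\<mu>' k # map \<mu>' xs) z))"
        using y by (intro exI[of _ "\<mu>(k := i)"]) (simp add: upd)
    qed
    show ?thesis unfolding A B computes_Mu_iff by auto
  qed
  ultimately show ?thesis by simp
qed

text \<open>Since \<open>xs\<close> lists variable names, the number of arguments is fixed, and a
  list that does not fit \<open>Succ\<close>, \<open>Proj\<close> or \<open>PrimRec\<close> makes
  the relation constantly false.\<close>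

theorem definable_computes:
  "set xs \<subseteq> {..<k} \<Longrightarrow> y < k \<Longrightarrow> definable k (\<lambda>\<mu>. computes f (map \<mu> xs) (\<mu> y))"
proof (induction f arbitrary: k xs y)
  case Zero
  then show ?case by (simp add: computes_Zero_iff definable_eq_0)
next
  case Succ
  show ?case
  proof (cases "\<exists>x. xs = [x]")
    case True
    then show ?thesis using Succ definable_eq[of _ k y 1] by (auto simp: computes_Succ_iff)
  next
    case False
    then have "\<not> computes Succ (map \<mu> xs) (\<mu> y)" for \<mu> by (auto simp: computes_Succ_iff)
    then show ?thesis by (simp add: definable_False)
  qed
next
  case (Proj i)
  show ?case
  proof (cases "i < length xs")
    case True
    then have "xs ! i < k" using Proj nth_mem by blast
    then show ?thesis
      using True Proj definable_eq[of "xs ! i" k y 0] by (simp add: computes_Proj_iff)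
  qed (simp add: computes_Proj_iff definable_False)
next
  case (Comp f gs)
  then show ?case by (intro definable_Comp)
next
  case (PrimRec f g)
  then show ?case
    by (cases xs) (simp_all add: not_computes_PrimRec_Nil definable_False definable_PrimRec
        del: list.map(2))
next
  case (Mu f)
  then show ?case by (intro definable_Mu)
qed

section \<open>The diagonal instance\<close>

lemma computes_Comp1: "computes g xs a \<Longrightarrow> computes f [a] z \<Longrightarrow> computes (Comp f [g]) xs z"
  by (rule computes.Comp[of _ _ "[a]"]) auto

lemma computes_Comp2:
  "computes g xs a \<Longrightarrow> computes h xs b \<Longrightarrow> computes f [a, b] z \<Longrightarrow> computes (Comp f [g, h]) xs z"
  by (rule computes.Comp[of _ _ "[a, b]"]) auto

lemma computes_ProjI: "i < length xs \<Longrightarrow> y = xs ! i \<Longrightarrow> computes (Proj i) xs y"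
  by (simp add: computes_Proj_iff)

definition rec_add :: recf where
  "rec_add = PrimRec (Proj 0) (Comp Succ [Proj 1])"

lemma computes_rec_add: "computes rec_add [m, n] (m + n)"
  unfolding rec_add_def computes_PrimRec_iff
  by (intro exI[of _ "\<lambda>i. i + n"])
    (auto intro!: computes_Comp1 computes_ProjI simp: computes_Succ_iff)

definition rec_triangle :: recf where
  "rec_triangle = PrimRec Zero (Comp rec_add [Proj 1, Comp Succ [Proj 0]])"

lemma computes_rec_triangle: "computes rec_triangle [n] (triangle n)"
  unfolding rec_triangle_def computes_PrimRec_iff
proof (intro exI[of _ triangle] conjI allI impI)
  fix i
  have "computes (Comp rec_add [Proj 1, Comp Succ [Proj 0]]) [i, triangle i] (triangle i + Suc i)"
    by (intro computes_Comp2[OF _ _ computes_rec_add] computes_Comp1[OF _ computes.Succ]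
        computes_ProjI) auto
  then show "computes (Comp rec_add [Proj 1, Comp Succ [Proj 0]]) [i, triangle i] (triangle (Suc i))"
    by simp
qed (auto simp: computes_Zero_iff)

text \<open>Cantor pairing: \<open>prod_encode (a, b)\<close> is
  \<open>triangle (a + b) + a\<close>.\<close>

definition rec_pair :: "recf \<Rightarrow> recf \<Rightarrow> recf" where
  "rec_pair f g = Comp rec_add [Comp rec_triangle [Comp rec_add [f, g]], f]"

lemma computes_rec_pair:
  "computes f xs a \<Longrightarrow> computes g xs b \<Longrightarrow> computes (rec_pair f g) xs (prod_encode (a, b))"
  unfolding rec_pair_def prod_encode_def prod.case
  by (intro computes_Comp2[OF _ _ computes_rec_add] computes_Comp1[OF _ computes_rec_triangle])

text \<open>\<open>list_encode\<close> takes the successor of the pair of head and coded tail, and a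
  natural number \<open>a\<close> has the integer code \<open>a + a\<close>.\<close>

definition rec_int_cons :: "recf \<Rightarrow> recf \<Rightarrow> recf" where
  "rec_int_cons f g = Comp Succ [rec_pair (Comp rec_add [f, f]) g]"

lemma computes_rec_int_cons:
  assumes "computes f xs a" "computes g xs (list_encode l)"
  shows "computes (rec_int_cons f g) xs (list_encode (int_encode (int a) # l))"
proof -
  have "int_encode (int a) = a + a" by (simp add: int_encode_def sum_encode_def)
  then show ?thesis
    unfolding rec_int_cons_def using assms
    by (simp, intro computes_Comp1[OF _ computes.Succ] computes_rec_pair
        computes_Comp2[OF _ _ computes_rec_add])
qed

theorem theorem1:
  shows "\<not> decidable_on enc_instance eg_instances eg_models"
proof
  assume "decidable_on enc_instance eg_instances eg_models"
  then obtain f where f: "\<And>i. i \<in> eg_instances \<Longrightarrow>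
      computes f [enc_instance i] (if eg_models i then 1 else 0)"
    unfolding decidable_on_def by blast
  \<comment> \<open>From the codes of the system, the formula and the remaining values,
    \<open>h\<close> computes the code of the instance. The last \<open>Proj 2\<close> occurs twice
    because its number is both the value of variable 2 and the code of the rest of the list.\<close>
  define h where "h = rec_pair (Proj 0) (rec_pair
      (rec_int_cons (Proj 0) (rec_int_cons (Proj 1) (rec_int_cons (Proj 2) (Proj 2)))) (Proj 1))"
  \<comment> \<open>A positive result in the scratch variable 3 stands for the answer 1.\<close>
  let ?R = "\<lambda>\<mu>. \<exists>\<mu>'. (\<forall>j<3. \<mu>' j = \<mu> j) \<and>
      ((0 < \<mu>' 3) \<and> computes (Comp f [h]) (map \<mu>' [0, 1, 2]) (\<mu>' 3))"
  have "definable 3 (\<lambda>\<mu>. \<not> ?R \<mu>)"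
    by (intro definable_not definable_ex[of 4] definable_conj definable_pos definable_computes) auto
  then obtain n where "\<forall>N\<ge>n. \<exists>\<phi>. expresses N \<phi> (\<lambda>\<mu>. \<not> ?R \<mu>)"
    using definable_expresses by blast
  then obtain N \<phi> where N: "3 \<le> N" and \<phi>: "expresses N \<phi> (\<lambda>\<mu>. \<not> ?R \<mu>)"
    using max.cobounded1[of n 3] max.cobounded2[of 3 n] by blast
  \<comment> \<open>\<open>C\<close> codes only the values from variable 3 on, all 0, so storing it
    in variable 2 is not circular. Likewise \<phi> is fixed before its code becomes the value of
    variable 1.\<close>
  define zs where "zs = map (\<lambda>_. int_encode 0) [3..<2 * N]"
  define A where "A = enc_gcs (copy_gcs N)"
  define B where "B = enc_formula \<phi>"
  define C where "C = list_encode zs"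
  define \<mu> where "\<mu> = (\<lambda>_. 0)(0 :: nat := A, 1 := B, 2 := C)"
  define i where "i = (copy_gcs N, nat_valuation N \<mu>, \<phi>)"
  have "[0..<2 * N] = 0 # 1 # 2 # [3..<2 * N]"
    using N by (simp add: upt_conv_Cons numeral_eq_Suc)
  moreover have "map (\<lambda>x. int_encode (nat_valuation N \<mu> x)) [3..<2 * N] = zs"
    by (auto simp: zs_def \<mu>_def)
  ultimately have "enc_valuation (copy_gcs N) (nat_valuation N \<mu>) =
      list_encode (int_encode (int A) # int_encode (int B) # int_encode (int C) # zs)"
    unfolding enc_valuation_def using N
    by (simp add: lessThan_atLeast0 del: list_encode.simps) (simp add: \<mu>_def)
  then have code: "enc_instance i = prod_encode (A, prod_encode (list_encode
      (int_encode (int A) # int_encode (int B) # int_encode (int C) # zs), B))"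
    by (simp add: i_def A_def B_def)
  have h: "computes h [A, B, C] (enc_instance i)"
    unfolding code h_def
    by (intro computes_rec_pair computes_rec_int_cons computes_ProjI) (auto simp: C_def)
  have "i \<in> eg_instances"
    using \<phi> by (simp add: i_def eg_instances_def gap_order_constraint_system_copy_gcs expresses_def)
  then have answer: "computes (Comp f [h]) [A, B, C] (if eg_models i then 1 else 0)"
    by (intro computes_Comp1[OF h] f)
  have "?R \<mu> \<longleftrightarrow> (\<exists>z>0. computes (Comp f [h]) [A, B, C] z)"
  proof
    assume "?R \<mu>"
    then obtain \<mu>' where \<mu>': "\<forall>j<3. \<mu>' j = \<mu> j" "0 < \<mu>' 3"
      "computes (Comp f [h]) (map \<mu>' [0, 1, 2]) (\<mu>' 3)" by blast
    have "map \<mu>' [0, 1, 2] = [A, B, C]" using \<mu>'(1) by (simp add: \<mu>_def)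
    with \<mu>' show "\<exists>z>0. computes (Comp f [h]) [A, B, C] z" by auto
  next
    assume "\<exists>z>0. computes (Comp f [h]) [A, B, C] z"
    then obtain z where "0 < z" "computes (Comp f [h]) [A, B, C] z" by blast
    then show "?R \<mu>" by (intro exI[of _ "\<mu>(3 := z)"]) (auto simp: \<mu>_def)
  qed
  \<comment> \<open>By determinism the answer of \<open>f\<close> is the only result, so a positive
    one exists only if that answer is 1.\<close>
  also have "\<dots> \<longleftrightarrow> eg_models i"
    using answer by (auto split: if_splits dest: computes_deterministic)
  also have "\<dots> \<longleftrightarrow> \<not> ?R \<mu>"
    using \<phi> by (simp add: i_def expresses_def)
  finally show False by argo
qed

end
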